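(* Let $n\ge 2$ and $d\ge 2$ be integers, and let $G$ be a graph on $n$ vertices with no isolated vertex such that the maximum degree of the complement $\overline{G}$ equals $d-1$. Then $$\mathrm{scc}(G)\le (e^2+1)\,n\,d\left\lceil \ln\left(\frac{n-1}{d-1}\right)\right\rceil.$$
   Context: All graphs are finite, simple and undirected; $\overline{G}$ denotes the complement of $G$. A clique of $G$ is a set of pairwise adjacent vertices, and a clique covering of $G$ is a family of cliques such that every edge of $G$ lies in at least one of them. $\mathrm{scc}(G)$ is the minimum of $\sum_{C\in\mathcal{C}}|C|$ over all clique coverings $\mathcal{C}$ of $G$. *)

theory Defs
  imports Complex_Main
begin

definition all_pairs :: "'a set \<Rightarrow> 'a set set" where
  "all_pairs V = {{u, v} | u v. u \<in> V \<and> v \<in> V \<and> u \<noteq> v}"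

definition simple_graph :: "'a set \<Rightarrow> 'a set set \<Rightarrow> bool" where
  "simple_graph V E \<longleftrightarrow> finite V \<and> E \<subseteq> all_pairs V"

definition complement_edges :: "'a set \<Rightarrow> 'a set set \<Rightarrow> 'a set set" where
  "complement_edges V E = all_pairs V - E"

definition vertex_degree :: "'a set \<Rightarrow> 'a set set \<Rightarrow> 'a \<Rightarrow> nat" where
  "vertex_degree V E v = card {u \<in> V. {v, u} \<in> E}"

definition max_degree :: "'a set \<Rightarrow> 'a set set \<Rightarrow> nat" where
  "max_degree V E = Max (vertex_degree V E ` V)"

definition isolated :: "'a set \<Rightarrow> 'a set set \<Rightarrow> 'a \<Rightarrow> bool" where
  "isolated V E v \<longleftrightarrow> v \<in> V \<and> (\<forall>u\<in>V. {v, u} \<notin> E)"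

definition clique :: "'a set \<Rightarrow> 'a set set \<Rightarrow> 'a set \<Rightarrow> bool" where
  "clique V E C \<longleftrightarrow> C \<subseteq> V \<and> (\<forall>u\<in>C. \<forall>v\<in>C. u \<noteq> v \<longrightarrow> {u, v} \<in> E)"

definition clique_covering :: "'a set \<Rightarrow> 'a set set \<Rightarrow> 'a set set \<Rightarrow> bool" where
  "clique_covering V E \<C> \<longleftrightarrow> (\<forall>C\<in>\<C>. clique V E C) \<and> (\<forall>e\<in>E. \<exists>C\<in>\<C>. e \<subseteq> C)"

text \<open>Families are sets of cliques: repeating a clique only increases the sum, so allowing
  multiplicities would not change the minimum. The minimum is over a finite nonempty set for
  every simple graph, as shown below.\<close>

definition scc :: "'a set \<Rightarrow> 'a set set \<Rightarrow> nat" where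
  "scc V E = Min {\<Sum>C\<in>\<C>. card C | \<C>. clique_covering V E \<C>}"

lemma finite_clique_coverings:
  assumes "simple_graph V E"
  shows "finite {\<C>. clique_covering V E \<C>}"
proof (rule finite_subset)
  show "{\<C>. clique_covering V E \<C>} \<subseteq> Pow (Pow V)"
    by (auto simp: clique_covering_def clique_def)
  show "finite (Pow (Pow V))"
    using assms by (simp add: simple_graph_def)
qed

lemma clique_covering_edges:
  assumes "simple_graph V E"
  shows "clique_covering V E E"
  unfolding clique_covering_def
proof (intro conjI ballI)
  fix e assume e: "e \<in> E"
  then obtain u v where uv: "e = {u, v}" "u \<in> V" "v \<in> V"
    using assms by (auto simp: simple_graph_def all_pairs_def)
  then show "clique V E e"
    using e by (auto simp: clique_def insert_commute)
  show "\<exists>C\<in>E. e \<subseteq> C"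
    using e by blast
qed

lemma scc_attained:
  assumes "simple_graph V E"
  obtains \<C> where "clique_covering V E \<C>" "scc V E = (\<Sum>C\<in>\<C>. card C)"
proof -
  let ?S = "{\<Sum>C\<in>\<C>. card C | \<C>. clique_covering V E \<C>}"
  have "finite ?S"
    using finite_clique_coverings[OF assms] by simp
  moreover have "?S \<noteq> {}"
    using clique_covering_edges[OF assms] by blast
  ultimately have "scc V E \<in> ?S"
    unfolding scc_def by (rule Min_in)
  then show thesis
    using that by blast
qed

lemma scc_le:
  assumes "simple_graph V E" "clique_covering V E \<C>"
  shows "scc V E \<le> (\<Sum>C\<in>\<C>. card C)"
  unfolding scc_def
  using finite_clique_coverings[OF assms(1)] assms(2) by (intro Min_le) auto

end

theory Submission
  imports Defs
begin

text \<open>Put every vertex into a random set \<open>S\<close> independently with probability \<open>1/d\<close> and keep the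
  clique of those vertices of \<open>S\<close> that are adjacent to all other vertices of \<open>S\<close>. Its expected size
  is at most \<open>n/d\<close>, and it contains the ends of a given edge with probability at least
  \<open>d\<^sup>-\<^sup>2 (1 - 1/d)\<^bsup>2(d-1)\<^esup> \<ge> (e d)\<^sup>-\<^sup>2\<close>. Draw \<open>t = \<lceil>e\<^sup>2 d\<^sup>2 L\<rceil>\<close> such cliques, where
  \<open>L = ln ((n-1)/(d-1))\<close>, and add every edge left uncovered as a clique of size 2. The expected
  total size is at most \<open>t n/d + n (n-1) exp (-L)\<close>, and \<open>n (n-1) exp (-L) = n (d-1)\<close>. Instead of a
  product space for the \<open>t\<close> draws, the cliques are chosen one after the other, each so that the
  conditional expectation of the total does not increase.\<close>

section \<open>Independent random vertex subsets\<close>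

text \<open>Finite sums over \<open>Pow V\<close> with these weights stand in for a probability
  space; only arguments \<open>S \<subseteq> V\<close> are of interest.\<close>

definition bernoulli_weight :: "real \<Rightarrow> 'a set \<Rightarrow> 'a set \<Rightarrow> real" where
  "bernoulli_weight p V S = p ^ card S * (1 - p) ^ card (V - S)"

text \<open>Both ends of a missing pair are dropped, with no tie-breaking. So whether a vertex of
  \<open>S\<close> survives depends only on \<open>S\<close> avoiding its non-neighbours, an event
  whose probability is easy to compute.\<close>

definition clique_core :: "'a set set \<Rightarrow> 'a set \<Rightarrow> 'a set" where
  "clique_core E S = {v \<in> S. \<forall>u\<in>S. u \<noteq> v \<longrightarrow> {u, v} \<in> E}"

lemma bernoulli_weight_nonneg: "0 \<le> p \<Longrightarrow> p \<le> 1 \<Longrightarrow> 0 \<le> bernoulli_weight p V S"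
  by (simp add: bernoulli_weight_def)

text \<open>Expand the product of \<open>f v + g v\<close> over \<open>V\<close>: since
  \<open>f\<close> vanishes on \<open>B\<close> and \<open>g\<close> on \<open>A\<close>, exactly
  the sets of the cylinder keep their weight. Evaluated factor by factor, the same product gives
  \<open>p\<close> on \<open>A\<close>, \<open>1 - p\<close> on \<open>B\<close> and 1
  elsewhere.\<close>

lemma sum_bernoulli_weight_cylinder:
  assumes "finite V" "A \<subseteq> V" "B \<subseteq> V" "A \<inter> B = {}"
  shows "(\<Sum>S\<in>{S\<in>Pow V. A \<subseteq> S \<and> S \<inter> B = {}}. bernoulli_weight p V S)
    = p ^ card A * (1 - p) ^ card B"
proof -
  define f where "f v = (if v \<in> B then 0 else p)" for v
  define g where "g v = (if v \<in> A then 0 else 1 - p)" for v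
  have "(\<Prod>v\<in>V. f v + g v)
      = (\<Prod>v\<in>V. (if v \<in> A then p else 1) * (if v \<in> B then 1 - p else 1))"
    using assms(4) by (intro prod.cong) (auto simp: f_def g_def)
  also have "\<dots> = p ^ card A * (1 - p) ^ card B"
    using assms by (simp add: prod.distrib prod.If_cases Int_absorb1)
  finally have lhs: "(\<Prod>v\<in>V. f v + g v) = p ^ card A * (1 - p) ^ card B" .
  have "(\<Prod>v\<in>V. f v + g v) = (\<Sum>S\<in>Pow V. prod f S * prod g (V - S))"
    using assms(1) by (rule prod_add)
  also have "\<dots> = (\<Sum>S\<in>Pow V. if A \<subseteq> S \<and> S \<inter> B = {} then bernoulli_weight p V S else 0)"
  proof (rule sum.cong[OF refl])
    fix S assume "S \<in> Pow V"
    then have fin: "finite S" "finite (V - S)"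
      using assms(1) by (auto intro: finite_subset)
    show "prod f S * prod g (V - S)
        = (if A \<subseteq> S \<and> S \<inter> B = {} then bernoulli_weight p V S else 0)"
    proof (cases "A \<subseteq> S \<and> S \<inter> B = {}")
      case True
      then have "prod f S = (\<Prod>v\<in>S. p)" "prod g (V - S) = (\<Prod>v\<in>V - S. 1 - p)"
        by (intro prod.cong; auto simp: f_def g_def)+
      with True show ?thesis
        by (simp add: bernoulli_weight_def)
    next
      case False
      then have "(\<exists>v\<in>V - S. g v = 0) \<or> (\<exists>v\<in>S. f v = 0)"
        using assms(2) by (auto simp: f_def g_def)
      with False fin show ?thesis
        by auto
    qed
  qed
  also have "\<dots> = (\<Sum>S\<in>{S\<in>Pow V. A \<subseteq> S \<and> S \<inter> B = {}}. bernoulli_weight p V S)"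
    using assms(1) by (intro sum.inter_filter[symmetric]) simp
  finally show ?thesis
    using lhs by simp
qed

lemma sum_bernoulli_weight:
  assumes "finite V"
  shows "(\<Sum>S\<in>Pow V. bernoulli_weight p V S) = 1"
  using sum_bernoulli_weight_cylinder[OF assms, of "{}" "{}" p] by (simp add: Pow_def)

text \<open>Linearity of expectation: after swapping the sums, each vertex contributes its
  probability \<open>p\<close> of being chosen.\<close>

lemma sum_bernoulli_weight_card:
  assumes "finite V"
  shows "(\<Sum>S\<in>Pow V. bernoulli_weight p V S * real (card S)) = real (card V) * p"
proof -
  have card: "real (card S) = (\<Sum>v\<in>V. if v \<in> S then 1 else 0)" if "S \<in> Pow V" for S
    using that assms by (simp add: sum.If_cases Int_absorb1)
  have "(\<Sum>S\<in>Pow V. bernoulli_weight p V S * real (card S))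
      = (\<Sum>S\<in>Pow V. \<Sum>v\<in>V. if v \<in> S then bernoulli_weight p V S else 0)"
    by (intro sum.cong refl) (simp add: card sum_distrib_left if_distrib cong: if_cong)
  also have "\<dots> = (\<Sum>v\<in>V. \<Sum>S\<in>Pow V. if v \<in> S then bernoulli_weight p V S else 0)"
    by (rule sum.swap)
  also have "\<dots> = (\<Sum>v\<in>V. p)"
  proof (rule sum.cong[OF refl])
    fix v assume "v \<in> V"
    have "(\<Sum>S\<in>Pow V. if v \<in> S then bernoulli_weight p V S else 0)
        = (\<Sum>S\<in>{S\<in>Pow V. v \<in> S}. bernoulli_weight p V S)"
      using assms by (intro sum.inter_filter[symmetric]) simp
    also have "\<dots> = p"
      using sum_bernoulli_weight_cylinder[OF assms, of "{v}" "{}" p] \<open>v \<in> V\<close> by simp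
    finally show "(\<Sum>S\<in>Pow V. if v \<in> S then bernoulli_weight p V S else 0) = p" .
  qed
  finally show ?thesis
    by simp
qed

text \<open>Turns a bound on an expectation into the existence of one good outcome.\<close>

lemma exists_le_weighted_average:
  fixes w f :: "'b \<Rightarrow> real"
  assumes "\<And>x. x \<in> A \<Longrightarrow> 0 \<le> w x" "(\<Sum>x\<in>A. w x) = 1" "(\<Sum>x\<in>A. w x * f x) \<le> M"
  shows "\<exists>x\<in>A. f x \<le> M"
proof (rule ccontr)
  assume "\<not> ?thesis"
  then have gt: "M < f x" if "x \<in> A" for x
    using that by auto
  \<comment> \<open>A sum over an infinite set is 0 by convention, so total weight 1 forces
    finiteness.\<close>
  have fin: "finite A"
    using assms(2) sum.infinite[of A w] by (metis zero_neq_one)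
  obtain y where y: "y \<in> A" "0 < w y"
    using assms(1,2) sum.neutral[of A w] by (metis order_le_less zero_neq_one)
  have "(\<Sum>x\<in>A. w x * M) < (\<Sum>x\<in>A. w x * f x)"
  proof (rule sum_strict_mono_ex1[OF fin])
    show "\<forall>x\<in>A. w x * M \<le> w x * f x"
      using assms(1) gt by (simp add: less_imp_le mult_left_mono)
    show "\<exists>x\<in>A. w x * M < w x * f x"
      using y gt[OF y(1)] by (intro bexI[of _ y] mult_strict_left_mono)
  qed
  then show False
    using assms(2,3) by (simp add: sum_distrib_right[symmetric])
qed

section \<open>Random cliques and the edges they cover\<close>

lemma clique_clique_core: "S \<subseteq> V \<Longrightarrow> clique V E (clique_core E S)"
  by (auto simp: clique_def clique_core_def)

lemma simple_graph_finite_edges: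
  assumes "simple_graph V E"
  shows "finite E"
proof (rule finite_subset)
  show "E \<subseteq> Pow V"
    using assms by (auto simp: simple_graph_def all_pairs_def)
  show "finite (Pow V)"
    using assms by (simp add: simple_graph_def)
qed

text \<open>The core contains \<open>e\<close> as soon as \<open>S\<close> contains both ends and
  avoids the set \<open>B\<close> of their non-neighbours. This is a cylinder event, and
  \<open>B\<close> has at most \<open>2 * k\<close> elements.\<close>

lemma sum_bernoulli_weight_edge_subset_clique_core:
  assumes G: "simple_graph V E" and e: "e \<in> E" and p: "0 \<le> p" "p \<le> 1"
    and deg: "\<And>v. v \<in> V \<Longrightarrow> vertex_degree V (complement_edges V E) v \<le> k"
  shows "p\<^sup>2 * (1 - p) ^ (2 * k)
    \<le> (\<Sum>S\<in>{S\<in>Pow V. e \<subseteq> clique_core E S}. bernoulli_weight p V S)"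
proof -
  have fin: "finite V"
    using G by (simp add: simple_graph_def)
  obtain u v where uv: "e = {u, v}" "u \<in> V" "v \<in> V" "u \<noteq> v"
    using G e by (auto simp: simple_graph_def all_pairs_def)
  define N where "N x = {y \<in> V. {x, y} \<in> complement_edges V E}" for x
  define B where "B = N u \<union> N v"
  have N: "y \<in> N x \<longleftrightarrow> y \<in> V \<and> y \<noteq> x \<and> {x, y} \<notin> E" if "x \<in> V" for x y
    using that by (auto simp: N_def complement_edges_def all_pairs_def doubleton_eq_iff)
  have "card B \<le> card (N u) + card (N v)"
    unfolding B_def by (rule card_Un_le)
  also have "\<dots> \<le> 2 * k"
    using deg[OF uv(2)] deg[OF uv(3)] by (simp add: vertex_degree_def N_def)
  finally have cardB: "card B \<le> 2 * k" .
  have BV: "B \<subseteq> V"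
    by (auto simp: B_def N_def)
  have disj: "{u, v} \<inter> B = {}"
    using e uv by (auto simp: B_def N insert_commute)
  have "p\<^sup>2 * (1 - p) ^ (2 * k) \<le> p ^ card {u, v} * (1 - p) ^ card B"
    using cardB p uv(4) by (auto intro!: mult_left_mono power_decreasing simp: power2_eq_square)
  also have "\<dots> = (\<Sum>S\<in>{S\<in>Pow V. {u, v} \<subseteq> S \<and> S \<inter> B = {}}. bernoulli_weight p V S)"
    using sum_bernoulli_weight_cylinder[OF fin _ BV disj] uv by simp
  also have "\<dots> \<le> (\<Sum>S\<in>{S\<in>Pow V. e \<subseteq> clique_core E S}. bernoulli_weight p V S)"
  proof (rule sum_mono2)
    show "{S\<in>Pow V. {u, v} \<subseteq> S \<and> S \<inter> B = {}} \<subseteq> {S\<in>Pow V. e \<subseteq> clique_core E S}"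
    proof (intro subsetI CollectI conjI)
      fix S x assume "S \<in> {S\<in>Pow V. {u, v} \<subseteq> S \<and> S \<inter> B = {}}" and x: "x \<in> e"
      then have S: "S \<subseteq> V" "{u, v} \<subseteq> S" "S \<inter> B = {}"
        by auto
      have "{y, x} \<in> E" if "y \<in> S" "y \<noteq> x" for y
      proof -
        have "y \<notin> N x"
          using that S x uv by (auto simp: B_def)
        then show ?thesis
          using that S x uv N[of x y] by (auto simp: insert_commute)
      qed
      then show "x \<in> clique_core E S"
        using S x uv by (auto simp: clique_core_def)
    qed auto
  qed (use fin p in \<open>auto intro: bernoulli_weight_nonneg\<close>)
  finally show ?thesis .
qed

text \<open>The factor \<open>c\<close> is a price per edge left uncovered. Size and price are
  bounded in expectation separately, and some \<open>S\<close> does no worse than the average of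
  their sum.\<close>

lemma exists_good_clique:
  assumes G: "simple_graph V E" and U: "U \<subseteq> E" and p: "0 \<le> p" "p \<le> 1" and c: "0 \<le> c"
    and deg: "\<And>v. v \<in> V \<Longrightarrow> vertex_degree V (complement_edges V E) v \<le> k"
    and q: "q \<le> p\<^sup>2 * (1 - p) ^ (2 * k)"
  shows "\<exists>C. clique V E C \<and>
    real (card C) + c * real (card {e\<in>U. \<not> e \<subseteq> C}) \<le> real (card V) * p + c * (real (card U) * (1 - q))"
proof -
  let ?w = "bernoulli_weight p V" and ?K = "clique_core E"
  have finV: "finite V"
    using G by (simp add: simple_graph_def)
  have finU: "finite U"
    using U simple_graph_finite_edges[OF G] by (rule finite_subset)
  have size: "(\<Sum>S\<in>Pow V. ?w S * real (card (?K S))) \<le> real (card V) * p"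
  proof -
    have "card (?K S) \<le> card S" if "S \<in> Pow V" for S
      using that finV by (intro card_mono) (auto simp: clique_core_def intro: finite_subset)
    then have "(\<Sum>S\<in>Pow V. ?w S * real (card (?K S))) \<le> (\<Sum>S\<in>Pow V. ?w S * real (card S))"
      by (intro sum_mono mult_left_mono) (auto simp: bernoulli_weight_nonneg p)
    then show ?thesis
      by (simp add: sum_bernoulli_weight_card[OF finV])
  qed
  have uncov: "(\<Sum>S\<in>Pow V. ?w S * real (card {e\<in>U. \<not> e \<subseteq> ?K S})) \<le> real (card U) * (1 - q)"
  proof -
    have "real (card {e\<in>U. \<not> e \<subseteq> ?K S}) = (\<Sum>e\<in>U. if e \<subseteq> ?K S then 0 else 1)" for S
      using finU by (simp add: sum.If_cases Int_def)
    then have "(\<Sum>S\<in>Pow V. ?w S * real (card {e\<in>U. \<not> e \<subseteq> ?K S}))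
        = (\<Sum>S\<in>Pow V. \<Sum>e\<in>U. ?w S - (if e \<subseteq> ?K S then ?w S else 0))"
      by (auto intro!: sum.cong simp: sum_distrib_left)
    also have "\<dots> = (\<Sum>e\<in>U. \<Sum>S\<in>Pow V. ?w S - (if e \<subseteq> ?K S then ?w S else 0))"
      by (rule sum.swap)
    also have "\<dots> \<le> (\<Sum>e\<in>U. 1 - q)"
    proof (rule sum_mono)
      fix e assume "e \<in> U"
      then have "q \<le> (\<Sum>S\<in>{S\<in>Pow V. e \<subseteq> ?K S}. ?w S)"
        using sum_bernoulli_weight_edge_subset_clique_core[OF G _ p deg] q U by (meson order_trans subsetD)
      also have "\<dots> = (\<Sum>S\<in>Pow V. if e \<subseteq> ?K S then ?w S else 0)"
        using finV by (intro sum.inter_filter) simp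
      finally show "(\<Sum>S\<in>Pow V. ?w S - (if e \<subseteq> ?K S then ?w S else 0)) \<le> 1 - q"
        by (simp add: sum_subtractf sum_bernoulli_weight[OF finV])
    qed
    finally show ?thesis
      by simp
  qed
  have "(\<Sum>S\<in>Pow V. ?w S * (real (card (?K S)) + c * real (card {e\<in>U. \<not> e \<subseteq> ?K S})))
      = (\<Sum>S\<in>Pow V. ?w S * real (card (?K S)))
        + c * (\<Sum>S\<in>Pow V. ?w S * real (card {e\<in>U. \<not> e \<subseteq> ?K S}))"
    by (simp add: distrib_left sum.distrib sum_distrib_left mult.left_commute)
  also have "\<dots> \<le> real (card V) * p + c * (real (card U) * (1 - q))"
    using size uncov c by (intro add_mono mult_left_mono)
  finally have "\<exists>S\<in>Pow V. real (card (?K S)) + c * real (card {e\<in>U. \<not> e \<subseteq> ?K S})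
      \<le> real (card V) * p + c * (real (card U) * (1 - q))"
    by (intro exists_le_weighted_average[of "Pow V" ?w])
      (simp_all add: bernoulli_weight_nonneg p sum_bernoulli_weight[OF finV])
  then show ?thesis
    using clique_clique_core by (metis PowD)
qed

text \<open>Induction on the number of draws, with \<open>U\<close> the edges still to be covered.
  Each draw adds at most \<open>card V * p\<close> to the bound and shrinks the leftover term by the
  factor \<open>1 - q\<close>; a final leftover edge costs 2.\<close>

lemma exists_good_clique_family:
  assumes G: "simple_graph V E" and U: "U \<subseteq> E" and p: "0 \<le> p" "p \<le> 1"
    and deg: "\<And>v. v \<in> V \<Longrightarrow> vertex_degree V (complement_edges V E) v \<le> k"
    and q: "q \<le> p\<^sup>2 * (1 - p) ^ (2 * k)" "q \<le> 1"
  shows "\<exists>\<F>. finite \<F> \<and> (\<forall>C\<in>\<F>. clique V E C) \<and>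
    real (\<Sum>C\<in>\<F>. card C) + 2 * real (card {e\<in>U. \<not> (\<exists>C\<in>\<F>. e \<subseteq> C)})
      \<le> real t * (real (card V) * p) + 2 * (real (card U) * (1 - q) ^ t)"
  using U
proof (induction t arbitrary: U)
  case 0
  show ?case
    by (rule exI[of _ "{}"]) simp
next
  case (Suc t)
  \<comment> \<open>The price of an edge missed by this clique is the bound on its expected cost
    with \<open>t\<close> draws to go: it survives each with probability at most
    \<open>1 - q\<close> and then costs 2.\<close>
  have "0 \<le> 2 * (1 - q) ^ t"
    using q(2) by simp
  from exists_good_clique[OF G Suc.prems p this deg q(1)] obtain C where C: "clique V E C"
    and C_le: "real (card C) + 2 * (1 - q) ^ t * real (card {e\<in>U. \<not> e \<subseteq> C})
      \<le> real (card V) * p + 2 * (1 - q) ^ t * (real (card U) * (1 - q))"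
    by blast
  have "{e\<in>U. \<not> e \<subseteq> C} \<subseteq> E"
    using Suc.prems by auto
  from Suc.IH[OF this] obtain \<F> where \<F>: "finite \<F>" "\<forall>D\<in>\<F>. clique V E D"
    and \<F>_le: "real (\<Sum>D\<in>\<F>. card D)
        + 2 * real (card {e\<in>{e\<in>U. \<not> e \<subseteq> C}. \<not> (\<exists>D\<in>\<F>. e \<subseteq> D)})
      \<le> real t * (real (card V) * p) + 2 * (real (card {e\<in>U. \<not> e \<subseteq> C}) * (1 - q) ^ t)"
    by blast
  have "{e\<in>{e\<in>U. \<not> e \<subseteq> C}. \<not> (\<exists>D\<in>\<F>. e \<subseteq> D)} = {e\<in>U. \<not> (\<exists>D\<in>insert C \<F>. e \<subseteq> D)}"
    by auto
  \<comment> \<open>Only an inequality, since \<open>C\<close> may already belong to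
    \<open>\<F>\<close>.\<close>
  moreover have "(\<Sum>D\<in>insert C \<F>. card D) \<le> card C + (\<Sum>D\<in>\<F>. card D)"
    using \<F>(1) by (simp add: sum.insert_if)
  then have "real (\<Sum>D\<in>insert C \<F>. card D) \<le> real (card C) + real (\<Sum>D\<in>\<F>. card D)"
    by linarith
  ultimately have "real (\<Sum>D\<in>insert C \<F>. card D)
        + 2 * real (card {e\<in>U. \<not> (\<exists>D\<in>insert C \<F>. e \<subseteq> D)})
      \<le> real (Suc t) * (real (card V) * p) + 2 * (real (card U) * (1 - q) ^ Suc t)"
    using C_le \<F>_le by (simp add: algebra_simps)
  then show ?case
    using C \<F> by (intro exI[of _ "insert C \<F>"]) simp
qed

section \<open>Completing the family, and numerical estimates\<close>

text \<open>Every leftover edge is added as a clique of size 2.\<close>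

lemma scc_le_clique_family:
  assumes G: "simple_graph V E" and \<F>: "finite \<F>" "\<forall>C\<in>\<F>. clique V E C"
  shows "scc V E \<le> (\<Sum>C\<in>\<F>. card C) + 2 * card {e\<in>E. \<not> (\<exists>C\<in>\<F>. e \<subseteq> C)}"
proof -
  let ?R = "{e\<in>E. \<not> (\<exists>C\<in>\<F>. e \<subseteq> C)}"
  have "clique_covering V E (\<F> \<union> ?R)"
    unfolding clique_covering_def
  proof (intro conjI ballI)
    show "clique V E C" if "C \<in> \<F> \<union> ?R" for C
      using that \<F>(2) clique_covering_edges[OF G] by (auto simp: clique_covering_def)
    show "\<exists>C\<in>\<F> \<union> ?R. e \<subseteq> C" if "e \<in> E" for e
      using that by (cases "\<exists>C\<in>\<F>. e \<subseteq> C") auto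
  qed
  then have "scc V E \<le> (\<Sum>C\<in>\<F> \<union> ?R. card C)"
    by (rule scc_le[OF G])
  also have "\<dots> \<le> (\<Sum>C\<in>\<F>. card C) + (\<Sum>C\<in>?R. card C)"
    using sum.union_inter[of \<F> ?R card] \<F>(1) simple_graph_finite_edges[OF G] by simp
  also have "(\<Sum>C\<in>?R. card C) = (\<Sum>C\<in>?R. 2)"
    using G by (intro sum.cong refl) (auto simp: simple_graph_def all_pairs_def)
  finally show ?thesis
    by simp
qed

lemma double_card_edges_le:
  assumes "simple_graph V E"
  shows "2 * card E \<le> card V * (card V - 1)"
proof -
  have fin: "finite V"
    using assms by (simp add: simple_graph_def)
  have "E \<subseteq> {e. e \<subseteq> V \<and> card e = 2}"
    using assms by (auto simp: simple_graph_def all_pairs_def)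
  then have "card E \<le> card {e. e \<subseteq> V \<and> card e = 2}"
    using fin by (intro card_mono) auto
  then have "card E \<le> card V * (card V - 1) div 2"
    using n_subsets[OF fin, of 2] by (simp add: choose_two)
  then show ?thesis
    by simp
qed

text \<open>With \<open>x = 1 / (d - 1)\<close> the base equals \<open>1 / (1 + x)\<close>, and
  \<open>1 + x \<le> exp x\<close>.\<close>

lemma one_minus_inverse_power_ge:
  fixes d :: nat
  assumes "2 \<le> d"
  shows "exp (-1) \<le> (1 - 1 / real d) ^ (d - 1)"
proof -
  define x where "x = 1 / real (d - 1)"
  have "1 - 1 / real d = 1 / (1 + x)"
    using assms by (simp add: x_def field_simps)
  moreover have "exp (- x) \<le> 1 / (1 + x)"
    using exp_ge_add_one_self[of x] by (simp add: x_def exp_minus field_simps add_pos_nonneg)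
  ultimately have "exp (- x) ^ (d - 1) \<le> (1 - 1 / real d) ^ (d - 1)"
    by (intro power_mono) auto
  moreover have "exp (- x) ^ (d - 1) = exp (-1)"
    using assms by (simp add: exp_of_nat_mult[symmetric] x_def)
  ultimately show ?thesis
    by simp
qed

section \<open>Choice of parameters and the final estimate\<close>

theorem theorem3:
  fixes V :: "'a set" and E :: "'a set set" and n d :: nat
  assumes "n \<ge> 2" and "d \<ge> 2"
    and "simple_graph V E" and "card V = n"
    and "\<not> (\<exists>v. isolated V E v)"
    and "max_degree V (complement_edges V E) = d - 1"
  shows "real (scc V E) \<le>
    ((exp 1)\<^sup>2 + 1) * real n * real d * of_int \<lceil>ln ((real n - 1) / (real d - 1))\<rceil>"
proof -
  note G = assms(3)
  have fin: "finite V" and ne: "V \<noteq> {}"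
    using assms by (auto simp: simple_graph_def)
  define L where "L = ln ((real n - 1) / (real d - 1))"
  have deg: "vertex_degree V (complement_edges V E) v \<le> d - 1" if "v \<in> V" for v
    unfolding assms(6)[symmetric] max_degree_def using fin that by (intro Max_ge) auto
  \<comment> \<open>A vertex \<open>v\<close> of maximum complement degree has a neighbour
    \<open>u\<close> in the graph, so its \<open>d - 1\<close> non-neighbours avoid both
    \<open>u\<close> and \<open>v\<close>. Hence \<open>d - 1 \<le> n - 2\<close>, which makes
    \<open>L\<close> positive.\<close>
  have "d - 1 \<in> vertex_degree V (complement_edges V E) ` V"
    unfolding assms(6)[symmetric] max_degree_def using fin ne by (intro Max_in) auto
  then obtain v where v: "v \<in> V" "vertex_degree V (complement_edges V E) v = d - 1"
    by (metis imageE)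
  obtain u where u: "u \<in> V" "{v, u} \<in> E"
    using assms(5) v(1) by (auto simp: isolated_def)
  have "u \<noteq> v"
    using u G by (auto simp: simple_graph_def all_pairs_def)
  have "{w \<in> V. {v, w} \<in> complement_edges V E} \<subseteq> V - {u, v}"
    using u by (auto simp: complement_edges_def all_pairs_def)
  then have "d - 1 \<le> card (V - {u, v})"
    using v(2) fin unfolding vertex_degree_def by (metis card_mono finite_Diff)
  also have "\<dots> = n - 2"
    using u v \<open>u \<noteq> v\<close> fin assms(4) by (simp add: card_Diff_subset)
  finally have "d < n"
    using assms(1,2) by simp
  then have L_pos: "0 < L"
    using assms(2) by (simp add: L_def)
  have exp_L: "(real n - 1) * exp (- L) = real d - 1"
    using \<open>d < n\<close> assms(2) by (simp add: L_def exp_minus)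

  define p where "p = 1 / real d"
  \<comment> \<open>A lower bound for the probability that a draw covers a given edge:
    \<open>p\<^sup>2\<close> for the two ends, and \<open>exp (-1)\<close> for the non-neighbours of
    each end.\<close>
  define q where "q = (exp (-1) * p)\<^sup>2"
  have p: "0 \<le> p" "p \<le> 1"
    using assms(2) by (auto simp: p_def)
  have "exp (-1) \<le> (1 - p) ^ (d - 1)"
    unfolding p_def using assms(2) by (rule one_minus_inverse_power_ge)
  then have "(exp (-1))\<^sup>2 \<le> ((1 - p) ^ (d - 1))\<^sup>2"
    by (intro power_mono) auto
  then have q: "q \<le> p\<^sup>2 * (1 - p) ^ (2 * (d - 1))"
    unfolding q_def by (simp add: power_mult_distrib power_mult[symmetric] mult.commute mult_left_mono)
  have q1: "q \<le> 1"
    unfolding q_def using p by (intro power_le_one mult_le_one) auto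
  have q_inv: "q * ((exp 1)\<^sup>2 * (real d)\<^sup>2) = 1"
    using assms(2) by (simp add: q_def p_def exp_minus field_simps)

  \<comment> \<open>The least number of draws with \<open>q * t \<ge> L\<close>, as \<open>q\<close>
    is the inverse of \<open>(exp 1)\<^sup>2 * (real d)\<^sup>2\<close>. Rounding up costs at most
    one extra draw.\<close>
  define t where "t = nat \<lceil>(exp 1)\<^sup>2 * (real d)\<^sup>2 * L\<rceil>"
  have t: "(exp 1)\<^sup>2 * (real d)\<^sup>2 * L \<le> real t" "real t \<le> (exp 1)\<^sup>2 * (real d)\<^sup>2 * L + 1"
    using L_pos unfolding t_def by (simp_all add: of_nat_ceiling)
  have "L = q * ((exp 1)\<^sup>2 * (real d)\<^sup>2 * L)"
    using q_inv by (simp add: mult.assoc[symmetric])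
  also have "\<dots> \<le> q * real t"
    using t(1) by (intro mult_left_mono) (simp_all add: q_def)
  finally have "exp (- (q * real t)) \<le> exp (- L)"
    by simp
  moreover have "(1 - q) ^ t \<le> exp (- q) ^ t"
    using q1 exp_ge_add_one_self[of "- q"] by (intro power_mono) auto
  moreover have "exp (- q) ^ t = exp (- (q * real t))"
    by (simp add: exp_of_nat_mult[symmetric] mult.commute)
  ultimately have decay: "(1 - q) ^ t \<le> exp (- L)"
    by linarith

  have "\<exists>\<F>. finite \<F> \<and> (\<forall>C\<in>\<F>. clique V E C) \<and>
      real (\<Sum>C\<in>\<F>. card C) + 2 * real (card {e\<in>E. \<not> (\<exists>C\<in>\<F>. e \<subseteq> C)})
        \<le> real t * (real (card V) * p) + 2 * (real (card E) * (1 - q) ^ t)"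
    by (rule exists_good_clique_family[OF G order_refl p _ q q1]) (rule deg)
  then obtain \<F> where \<F>: "finite \<F>" "\<forall>C\<in>\<F>. clique V E C"
    and \<F>_le: "real (\<Sum>C\<in>\<F>. card C) + 2 * real (card {e\<in>E. \<not> (\<exists>C\<in>\<F>. e \<subseteq> C)})
      \<le> real t * (real (card V) * p) + 2 * (real (card E) * (1 - q) ^ t)"
    by (elim exE conjE)
  have "real (2 * card E) \<le> real (n * (n - 1))"
    using double_card_edges_le[OF G] assms(4) by (simp only: of_nat_le_iff)
  then have edges: "2 * real (card E) \<le> real n * (real n - 1)"
    using assms(1) by simp
  have "real (scc V E) \<le> real (\<Sum>C\<in>\<F>. card C) + 2 * real (card {e\<in>E. \<not> (\<exists>C\<in>\<F>. e \<subseteq> C)})"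
    using scc_le_clique_family[OF G \<F>] by linarith
  also have "\<dots> \<le> real t * (real n * p) + 2 * real (card E) * (1 - q) ^ t"
    using \<F>_le assms(4) by simp
  also have "\<dots> \<le> ((exp 1)\<^sup>2 * (real d)\<^sup>2 * L + 1) * (real n * p) + real n * (real n - 1) * exp (- L)"
  proof (intro add_mono)
    show "real t * (real n * p) \<le> ((exp 1)\<^sup>2 * (real d)\<^sup>2 * L + 1) * (real n * p)"
      using t(2) p by (intro mult_right_mono) auto
    show "2 * real (card E) * (1 - q) ^ t \<le> real n * (real n - 1) * exp (- L)"
      using assms(1) q1 by (intro mult_mono[OF edges decay]) auto
  qed
  \<comment> \<open>The extra draw contributes \<open>n * p\<close>, grouped here with the leftover
    edges, whose term becomes \<open>n * (d - 1)\<close> by \<open>exp_L\<close>.\<close>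
  also have "\<dots> = (exp 1)\<^sup>2 * real n * real d * (real d * p) * L
      + real n * (p + (real n - 1) * exp (- L))"
    by (simp add: power2_eq_square algebra_simps)
  also have "\<dots> = (exp 1)\<^sup>2 * real n * real d * L + real n * (p + real d - 1)"
    using assms(2) by (simp add: exp_L p_def)
  also have "\<dots> \<le> (exp 1)\<^sup>2 * real n * real d * \<lceil>L\<rceil> + real n * real d * \<lceil>L\<rceil>"
  proof (rule add_mono)
    show "(exp 1)\<^sup>2 * real n * real d * L \<le> (exp 1)\<^sup>2 * real n * real d * \<lceil>L\<rceil>"
      by (rule mult_left_mono) simp_all
    \<comment> \<open>Since \<open>L > 0\<close>, the ceiling is at least 1. As
      \<open>p \<le> 1\<close>, the extra draw and the leftover edges together cost at most
      \<open>n * d\<close>, which is the summand 1 in the constant.\<close>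
    have "1 \<le> \<lceil>L\<rceil>"
      using L_pos by simp
    then have "1 \<le> real_of_int \<lceil>L\<rceil>"
      by (simp only: of_int_1_le_iff)
    then have "real d * 1 \<le> real d * \<lceil>L\<rceil>"
      by (rule mult_left_mono) simp
    then have "p + real d - 1 \<le> real d * \<lceil>L\<rceil>"
      using p(2) by linarith
    then show "real n * (p + real d - 1) \<le> real n * real d * \<lceil>L\<rceil>"
      unfolding mult.assoc by (rule mult_left_mono) simp
  qed
  also have "\<dots> = ((exp 1)\<^sup>2 + 1) * real n * real d * \<lceil>L\<rceil>"
    by (simp only: distrib_right mult_1)
  finally show ?thesis
    unfolding L_def .
qed

end
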